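(* Fix a depth $\Delta\in\mathbb{N}_+$, a width $\Upsilon\in \mathbb{N}_+$, and bits (layer widths) $B_{in}=B_0,B_1,\dots,B_{\Delta}=B_{out}=1\in \mathbb{N}_+$. Then, for any matrices $W\in\mathbb{R}^{B_1\times 2B_{in}}$, $\{W^{(l:\sigma)}\}_{l=1}^{\Delta-1}$ and random adjacency matrices $\{\mathbf{E}^{(l:1:e)}\}_{l=1}^{\Delta-1}$, $\{\mathbf{E}^{(l:2:e)}\}_{l=1}^{\Delta-1}$ as in the Stochastic Boolean Circuit model described in the context, the random function $\boldsymbol{\mathcal{C}}$ (the Stochastic Boolean Circuit) satisfies \[ \mathbb{P}\big( \boldsymbol{\mathcal{C}} \in \operatorname{CIRCUIT}_{\Delta,\Upsilon}^{B_{in}}\big) = 1 . \]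
   Context: All random variables are defined on a fixed probability space $(\Omega,\mathcal{F},\mathbb{P})$. For $N\in\mathbb{N}_+$, $\operatorname{SM}_N:\mathbb{R}^N\to\Delta_N$ is the softmax $\operatorname{SM}_N(x)=\big(e^{x_n}/\sum_{m=1}^N e^{x_m}\big)_{n=1}^N$ (applied row-wise to matrices); $\odot$ is the Hadamard product; $\mathbf{1}_N$ is the all-ones vector; $e_i$ are standard basis vectors. $\mathbb{G}^\star=\{g_1,\dots,g_{16}\}$ is the set of all $16$ Boolean gates $g:\{0,1\}^2\to\{0,1\}$ (fan-in 2, fan-out 1), where $g_i$ has truth table $Z^{(i)}\in\{0,1\}^4$ on the inputs ordered $\bar x_1=(0,0),\bar x_2=(0,1),\bar x_3=(1,0),\bar x_4=(1,1)$, and $Z^{(1)}=(0,0,0,0),\dots,Z^{(16)}=(1,1,1,1)$ enumerates $\{0,1\}^4$. Boolean circuit class: $\operatorname{CIRCUIT}_{\Delta,\Upsilon}^B$ is the set of Boolean circuits $\mathcal{C}=(V,E,g_\cdot)$ with $B$ input bits, depth $\Delta$ and width $\Upsilon$: $(V,E)$ is a DAG with $B$ root/input nodes and one output node, layered as $V=\bigsqcup_{l=0}^\Delta V_l$ with $V_0$ the input nodes, $V_\Delta=\{v_{out}\}$, and every edge going from some $V_l$ to $V_{l+1}$; there is an initial bit-lifting channel $x\mapsto \Pi\binom{x}{\mathbf{1}_B-x}$ with $\Pi$ a matrix whose rows are one-hot (selecting bits and their negations, repetitions allowed); every other non-root (computational) node $v$ has in-degree exactly $2$ (predecessors $v_{-1},v_{-2}$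 in the previous layer) and is decorated by a gate $g_v\in\mathbb{G}^\star$. The induced function is $f_{\mathcal C}=f_\Delta$, where $f_1(x)=\Pi\binom{x}{\mathbf{1}_B-x}$ and $f_l(x)=\big(g_v(f_{l-1}(x)_{v_{-1}},f_{l-1}(x)_{v_{-2}})\big)_{v\in V_l}$ for $l=2,\dots,\Delta$. A random function is said to lie in $\operatorname{CIRCUIT}_{\Delta,\Upsilon}^{B}$ if it is computed by (equals the induced function of) such a circuit. Stochastic Boolean Circuit model: (1) Stochastic bit-lifting channel: for $W\in\mathbb{R}^{B_1\times 2B_{in}}$, $\mathbf{X}^{\uparrow:W}$ is a random map $\{0,1\}^{B_{in}}\to\{0,1\}^{B_1}$ whose $i$-th coordinate has law $\mathbf{X}^{\uparrow:W}_i(x)\sim\sum_{j=1}^{B_{in}}\operatorname{SM}_{2B_{in}}(W_{i:})_j\,\delta_{x_j}+\sum_{j=1}^{B_{in}}\operatorname{SM}_{2B_{in}}(W_{i:})_{j+B_{in}}\,\delta_{\neg x_j}$. (2) Stochastic Boolean gates: let $\varsigma(x)=e\cdot e^{1/(4\|x\|_2^2-1)}$ if $\|x\|_2<\tfrac12$ and $\varsigma(x)=0$ otherwise, and $\tilde\sigma(x\mid Z)=\sum_{i=1}^4\varsigma(x-\bar x_i)Z_i$ for $x\in\mathbb{R}^2$, $Z\in\{0,1\}^4$. For $W_\Sigma\in\mathbb{R}^{16}$, the random gate is $\boldsymbol{\sigma}^{W_\Sigma}(\omega)(x)=\sum_{i=1}^{16}X_i^{W_\Sigma}(\omega)\,\tilde\sigma(x\mid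 Z^{(i)})$ with $\mathbb{P}(X^{W_\Sigma}=e_i)=\operatorname{SM}_{16}(W_\Sigma)_i$. For $W^{(l:\sigma)}\in\mathbb{R}^{B_{l+1}\times16}$, $\boldsymbol{\sigma}^{W^{(l:\sigma)}}(x,y)=\big(\boldsymbol{\sigma}^{W^{(l:\sigma)}_j}(x_j,y_j)\big)_{j=1}^{B_{l+1}}$. (3) Random edges: for a temperature $\eta>0$, layers $l=1,\dots,\Delta-1$ and weights $W^{(l:1)},W^{(l:2)}\in\mathbb{R}^{B_{l+1}\times B_l}$, let $E^{(l:1)}$ have $j$-th row $\operatorname{SM}(\eta W^{(l:1)}_j)$ and $E^{(l:2)}$ have $j$-th row $\operatorname{SM}\big(\eta(1-\operatorname{SM}(\eta W^{(l:1)}_j))\odot\operatorname{SM}(\eta W^{(l:2)}_j)\big)$; the random adjacency matrices $\mathbf{E}^{(l:1:e)},\mathbf{E}^{(l:2:e)}\in\mathbb{R}^{B_{l+1}\times B_l}$ have $j$-th rows drawn as one-hot vectors in $\{e_1,\dots,e_{B_l}\}$ with mean the $j$-th row of $E^{(l:1)}$, respectively $E^{(l:2)}$. (4) Recursion: the Stochastic Boolean Circuit $\boldsymbol{\mathcal{C}}:\Omega\times\{0,1\}^{B_{in}}\to\{0,1\}^{B_{out}}$ is $\boldsymbol{\mathcal{C}}(x)=\mathbf{x}^{(\Delta)}$, where $\mathbf{x}^{(1)}=\mathbf{X}^{\uparrow:W}(x)$ and $\mathbf{x}^{(l+1)}=\boldsymbol{\sigma}^{W^{(l:\sigma)}}\big(\mathbf{E}^{(l:1:e)}\mathbf{x}^{(l)},\mathbf{E}^{(l:2:e)}\mathbf{x}^{(l)}\big)$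 for $l=1,\dots,\Delta-1$ (dependence on $\omega$ suppressed).
   Formalization: All layer widths B_0,…,B_Δ are assumed at most Υ (otherwise the claim fails, e.g. Υ=1, B_0=B_1=2, Δ=2); each bit-lifting coordinate is a random map selecting one bit or its negation for all x; circuits may have parallel edges, needed when a layer has one node. *)

theory Defs
  imports
    "HOL-Probability.Probability"
    "Jordan_Normal_Form.Matrix"
    "Graph_Theory.Digraph"
begin

unbundle no vec_syntax
hide_const (open) Finite_Cartesian_Product.vec Finite_Cartesian_Product.mat Finite_Cartesian_Product.row

text \<open>Bits are the real numbers 0 and 1. Vectors and matrices are those of
  Jordan_Normal_Form, so all indices start at 0; layer numbers are as in the usual
  mathematical description, with layer 0 the inputs.\<close>

definition bits :: "nat \<Rightarrow> real vec set" where
  "bits n = {x \<in> carrier_vec n. \<forall>i<n. x $ i \<in> {0, 1}}"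

definition softmax :: "real vec \<Rightarrow> real vec" where
  "softmax x = vec (dim_vec x) (\<lambda>n. exp (x $ n) / (\<Sum>m<dim_vec x. exp (x $ m)))"

definition ones :: "nat \<Rightarrow> real vec" where
  "ones n = vec n (\<lambda>_. 1)"

definition hadamard :: "real vec \<Rightarrow> real vec \<Rightarrow> real vec" where
  "hadamard x y = vec (dim_vec x) (\<lambda>n. x $ n * y $ n)"

section \<open>Boolean circuits\<close>

definition boolean_gates :: "(real \<times> real \<Rightarrow> real) set" where
  "boolean_gates = ({0, 1} \<times> {0, 1}) \<rightarrow>\<^sub>E {0, 1}"

text \<open>Nodes and edges are named by natural numbers, which is no restriction for finite
  graphs. The graph may have parallel edges: a gate node always has two incoming edges,
  but these may start at the same predecessor (as they must when the previous layer has a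
  single node). The two edges are ordered, since a gate need not be symmetric.\<close>

record circuit =
  graph :: "(nat, nat) pre_digraph"
  layer :: "nat \<Rightarrow> nat set"
  input_node :: "nat \<Rightarrow> nat"
  lift_row :: "nat \<Rightarrow> real vec"  \<comment> \<open>rows of the bit-lifting matrix, indexed by the first layer\<close>
  in_arc1 :: "nat \<Rightarrow> nat"
  in_arc2 :: "nat \<Rightarrow> nat"
  gate :: "nat \<Rightarrow> real \<times> real \<Rightarrow> real"
  output_node :: nat

abbreviation pred1 :: "circuit \<Rightarrow> nat \<Rightarrow> nat" where
  "pred1 C v \<equiv> tail (graph C) (in_arc1 C v)"

abbreviation pred2 :: "circuit \<Rightarrow> nat \<Rightarrow> nat" where
  "pred2 C v \<equiv> tail (graph C) (in_arc2 C v)"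

text \<open>The width is the largest number of nodes in a layer, and a circuit class of width
  \<open>\<Upsilon>\<close> bounds it by \<open>\<Upsilon>\<close>. A node of the first layer
  selects bit \<open>i\<close> (column \<open>i\<close> of the lifting matrix) or its negation
  (column \<open>b + i\<close>), and its only incoming edge comes from input node
  \<open>i\<close>. The classes are meant for \<open>\<Delta> \<ge> 1\<close>.\<close>

definition CIRCUIT :: "nat \<Rightarrow> nat \<Rightarrow> nat \<Rightarrow> circuit set" where
  "CIRCUIT b \<Delta> \<Upsilon> = {C.
     fin_digraph (graph C) \<and> acyclic (arcs_ends (graph C)) \<and>
     verts (graph C) = (\<Union>l\<le>\<Delta>. layer C l) \<and> disjoint_family_on (layer C) {..\<Delta>} \<and>
     (\<forall>a\<in>arcs (graph C). \<exists>l<\<Delta>. tail (graph C) a \<in> layer C l \<and> head (graph C) a \<in> layer C (Suc l)) \<and>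
     bij_betw (input_node C) {..<b} (layer C 0) \<and>
     layer C \<Delta> = {output_node C} \<and>
     (\<forall>l\<le>\<Delta>. card (layer C l) \<le> \<Upsilon>) \<and>
     (\<forall>v\<in>layer C 1. \<exists>j<2 * b. lift_row C v = unit_vec (2 * b) j \<and>
        (\<exists>a. in_arcs (graph C) v = {a} \<and> tail (graph C) a = input_node C (j mod b))) \<and>
     (\<forall>l\<in>{2..\<Delta>}. \<forall>v\<in>layer C l.
        in_degree (graph C) v = 2 \<and> in_arcs (graph C) v = {in_arc1 C v, in_arc2 C v} \<and>
        gate C v \<in> boolean_gates)}"

text \<open>The value of node \<open>v\<close> in layer \<open>l \<ge> 1\<close>.\<close>

fun layer_value :: "circuit \<Rightarrow> real vec \<Rightarrow> nat \<Rightarrow> nat \<Rightarrow> real" where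
  "layer_value C x (Suc 0) v = scalar_prod (lift_row C v) (x @\<^sub>v (ones (dim_vec x) - x))"
| "layer_value C x (Suc (Suc l)) v =
     gate C v (layer_value C x (Suc l) (pred1 C v), layer_value C x (Suc l) (pred2 C v))"

definition circuit_fun :: "nat \<Rightarrow> circuit \<Rightarrow> real vec \<Rightarrow> real vec" where
  "circuit_fun \<Delta> C x = vec 1 (\<lambda>_. layer_value C x \<Delta> (output_node C))"

definition computed_by_CIRCUIT :: "nat \<Rightarrow> nat \<Rightarrow> nat \<Rightarrow> (real vec \<Rightarrow> real vec) \<Rightarrow> bool" where
  "computed_by_CIRCUIT b \<Delta> \<Upsilon> f \<longleftrightarrow>
     (\<exists>C\<in>CIRCUIT b \<Delta> \<Upsilon>. \<forall>x\<in>bits b. f x = circuit_fun \<Delta> C x)"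

section \<open>Stochastic Boolean circuits\<close>

definition random_vector :: "'a measure \<Rightarrow> nat \<Rightarrow> ('a \<Rightarrow> real vec) \<Rightarrow> bool" where
  "random_vector M n R \<longleftrightarrow>
     (\<forall>\<omega>\<in>space M. R \<omega> \<in> carrier_vec n) \<and> (\<forall>k<n. (\<lambda>\<omega>. R \<omega> $ k) \<in> borel_measurable M)"

text \<open>The Dirac masses of the bit-lifting channel sit at the coordinate maps
  \<open>x \<mapsto> x\<^sub>j\<close> and \<open>x \<mapsto> \<not> x\<^sub>j\<close>: coordinate
  \<open>i\<close> of \<open>X\<close> is a random map on bit vectors with the law below, so the
  selected bit does not change with the input \<open>x\<close>. The joint law of the coordinates is
  not constrained.\<close>

definition bit_lifting_channel ::
    "'a measure \<Rightarrow> nat \<Rightarrow> nat \<Rightarrow> real mat \<Rightarrow> ('a \<Rightarrow> real vec \<Rightarrow> real vec) \<Rightarrow> bool" where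
  "bit_lifting_channel M b n W X \<longleftrightarrow>
     (\<forall>\<omega>\<in>space M. \<forall>x\<in>bits b. X \<omega> x \<in> bits n) \<and>
     (\<forall>i<n.
        (\<lambda>\<omega>. \<lambda>x\<in>bits b. X \<omega> x $ i) \<in> measurable M (count_space UNIV) \<and>
        (\<forall>A. measure M {\<omega> \<in> space M. (\<lambda>x\<in>bits b. X \<omega> x $ i) \<in> A} =
           (\<Sum>j<b. softmax (row W i) $ j * indicator A (\<lambda>x\<in>bits b. x $ j)) +
           (\<Sum>j<b. softmax (row W i) $ (j + b) * indicator A (\<lambda>x\<in>bits b. 1 - x $ j))))"

definition bump :: "real \<times> real \<Rightarrow> real" where
  "bump p = (if norm p < 1 / 2 then exp 1 * exp (1 / (4 * (norm p)\<^sup>2 - 1)) else 0)"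

text \<open>The inputs \<open>(0,0), (0,1), (1,0), (1,1)\<close> in this order, and the truth
  tables \<open>(0,0,0,0), (0,0,0,1), \<dots>, (1,1,1,1)\<close> in lexicographic order.\<close>

definition gate_input :: "nat \<Rightarrow> real \<times> real" where
  "gate_input k = (real (k div 2), real (k mod 2))"

definition truth_table :: "nat \<Rightarrow> real vec" where
  "truth_table i = vec 4 (\<lambda>k. real (i div 2 ^ (3 - k) mod 2))"

definition smooth_gate :: "real \<times> real \<Rightarrow> real vec \<Rightarrow> real" where
  "smooth_gate p Z = (\<Sum>k<4. bump (p - gate_input k) * Z $ k)"

definition gate_choice :: "'a measure \<Rightarrow> real vec \<Rightarrow> ('a \<Rightarrow> real vec) \<Rightarrow> bool" where
  "gate_choice M w G \<longleftrightarrow> random_vector M 16 G \<and>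
     (\<forall>i<16. measure M {\<omega> \<in> space M. G \<omega> = unit_vec 16 i} = softmax w $ i)"

definition random_gate :: "real vec \<Rightarrow> real \<times> real \<Rightarrow> real" where
  "random_gate g p = (\<Sum>i<16. g $ i * smooth_gate p (truth_table i))"

definition edge_prob1 :: "real \<Rightarrow> real mat \<Rightarrow> real mat" where
  "edge_prob1 \<eta> W1 = mat (dim_row W1) (dim_col W1)
     (\<lambda>(j, k). softmax (\<eta> \<cdot>\<^sub>v row W1 j) $ k)"

definition edge_prob2 :: "real \<Rightarrow> real mat \<Rightarrow> real mat \<Rightarrow> real mat" where
  "edge_prob2 \<eta> W1 W2 = mat (dim_row W2) (dim_col W2)
     (\<lambda>(j, k). softmax (hadamard
        (\<eta> \<cdot>\<^sub>v (ones (dim_col W1) - softmax (\<eta> \<cdot>\<^sub>v row W1 j)))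
        (softmax (\<eta> \<cdot>\<^sub>v row W2 j))) $ k)"

definition random_one_hot :: "'a measure \<Rightarrow> real vec \<Rightarrow> ('a \<Rightarrow> real vec) \<Rightarrow> bool" where
  "random_one_hot M p R \<longleftrightarrow> random_vector M (dim_vec p) R \<and>
     (AE \<omega> in M. R \<omega> \<in> unit_vec (dim_vec p) ` {..<dim_vec p}) \<and>
     (\<forall>k<dim_vec p. integral\<^sup>L M (\<lambda>\<omega>. R \<omega> $ k) = p $ k)"

definition random_adjacency :: "'a measure \<Rightarrow> real mat \<Rightarrow> ('a \<Rightarrow> real mat) \<Rightarrow> bool" where
  "random_adjacency M P E \<longleftrightarrow>
     (\<forall>\<omega>\<in>space M. E \<omega> \<in> carrier_mat (dim_row P) (dim_col P)) \<and>
     (\<forall>j<dim_row P. random_one_hot M (row P j) (\<lambda>\<omega>. row (E \<omega>) j))"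

text \<open>The state in layer \<open>l \<ge> 1\<close>. The randomness enters through the
  bit-lifting channel \<open>X\<close>, the gate choices \<open>G l j\<close> and the adjacency
  matrices \<open>E1 l\<close>, \<open>E2 l\<close> between layers \<open>l\<close> and
  \<open>l + 1\<close>.\<close>

fun sbc_state :: "(nat \<Rightarrow> nat) \<Rightarrow> ('a \<Rightarrow> real vec \<Rightarrow> real vec) \<Rightarrow> (nat \<Rightarrow> nat \<Rightarrow> 'a \<Rightarrow> real vec) \<Rightarrow>
    (nat \<Rightarrow> 'a \<Rightarrow> real mat) \<Rightarrow> (nat \<Rightarrow> 'a \<Rightarrow> real mat) \<Rightarrow> nat \<Rightarrow> 'a \<Rightarrow> real vec \<Rightarrow> real vec" where
  "sbc_state B X G E1 E2 (Suc 0) \<omega> x = X \<omega> x"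
| "sbc_state B X G E1 E2 (Suc (Suc l)) \<omega> x =
     (let s = sbc_state B X G E1 E2 (Suc l) \<omega> x;
          y = E1 (Suc l) \<omega> *\<^sub>v s;
          z = E2 (Suc l) \<omega> *\<^sub>v s
      in vec (B (Suc (Suc l))) (\<lambda>j. random_gate (G (Suc l) j \<omega>) (y $ j, z $ j)))"

definition stochastic_boolean_circuit :: "nat \<Rightarrow> (nat \<Rightarrow> nat) \<Rightarrow> ('a \<Rightarrow> real vec \<Rightarrow> real vec) \<Rightarrow>
    (nat \<Rightarrow> nat \<Rightarrow> 'a \<Rightarrow> real vec) \<Rightarrow> (nat \<Rightarrow> 'a \<Rightarrow> real mat) \<Rightarrow> (nat \<Rightarrow> 'a \<Rightarrow> real mat) \<Rightarrow>
    'a \<Rightarrow> real vec \<Rightarrow> real vec" where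
  "stochastic_boolean_circuit \<Delta> B X G E1 E2 = sbc_state B X G E1 E2 \<Delta>"

end

theory Submission
  imports Defs
begin

text \<open>Almost surely every row of the random adjacency matrices and every gate choice is one-hot, and
  every coordinate of the lifting channel is a coordinate map or its negation. On this event the
  sampled rows and gates are the wiring and the gates of a Boolean circuit with the same layer
  widths; on bits, the smooth gates agree with their truth tables because the bump function is 1 at
  its centre and vanishes at the other three corners.\<close>

section \<open>Bits and gates\<close>

text \<open>A bit vector is determined by its entries. Finiteness is what later reduces the event to
  finitely many equations between random variables.\<close>

lemma finite_bits: "finite (bits n)"
proof -
  have "bits n \<subseteq> (\<lambda>f. vec n f) ` ({..<n} \<rightarrow>\<^sub>E {0, 1})"
  proof
    fix x :: "real vec" assume x: "x \<in> bits n"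
    have "x = vec n (\<lambda>i\<in>{..<n}. x $ i)"
      using x by (auto simp: bits_def)
    moreover have "(\<lambda>i\<in>{..<n}. x $ i) \<in> {..<n} \<rightarrow>\<^sub>E {0, 1}"
      using x by (auto simp: bits_def)
    ultimately show "x \<in> (\<lambda>f. vec n f) ` ({..<n} \<rightarrow>\<^sub>E {0, 1})"
      by (rule image_eqI)
  qed
  then show ?thesis
    by (rule finite_subset) (auto intro!: finite_imageI finite_PiE)
qed

text \<open>Supplies total mass one for the gate law and for the bit-lifting law; the empty vector
  is excluded because its sum is 0.\<close>

lemma sum_softmax:
  assumes "0 < dim_vec x"
  shows "(\<Sum>i<dim_vec x. softmax x $ i) = 1"
proof -
  have "(\<Sum>m<dim_vec x. exp (x $ m)) > 0"
    using assms by (intro sum_pos) auto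
  then show ?thesis
    by (simp add: softmax_def flip: sum_divide_distrib)
qed

section \<open>Smooth gates on bit pairs\<close>

text \<open>Distinct corners of the unit square are at least 1 apart, outside the support radius
  1/2, while at the centre the factors \<open>exp 1\<close> and \<open>exp (-1)\<close>
  cancel.\<close>

lemma bump_gate_input:
  assumes "k < 4" "m < 4"
  shows "bump (gate_input k - gate_input m) = (if k = m then 1 else 0)"
proof -
  have "k \<in> {0, 1, 2, 3}" "m \<in> {0, 1, 2, 3}"
    using assms by auto
  \<comment> \<open>Opposite corners are sqrt 2 apart; this excludes a distance below 1/2 for
    them.\<close>
  moreover have "\<not> sqrt 2 * 2 < (1 :: real)"
    using real_sqrt_ge_one[of 2] by linarith
  ultimately show ?thesis
    by (auto simp: bump_def gate_input_def norm_Pair zero_prod_def simp flip: exp_add)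
qed

lemma smooth_gate_gate_input:
  assumes "k < 4"
  shows "smooth_gate (gate_input k) Z = Z $ k"
  using assms by (simp add: smooth_gate_def bump_gate_input if_distrib if_distribR cong: if_cong)

lemma bit_pair_gate_input:
  assumes "p \<in> {0, 1} \<times> {0, 1}"
  shows "\<exists>k<4. p = gate_input k"
proof -
  have "p = gate_input 0 \<or> p = gate_input 1 \<or> p = gate_input 2 \<or> p = gate_input 3"
    using assms by (auto simp: gate_input_def)
  then show ?thesis
    by (auto intro: exI[of _ 0] exI[of _ 1] exI[of _ 2] exI[of _ 3])
qed

lemma random_gate_unit_vec:
  assumes "i < 16"
  shows "random_gate (unit_vec 16 i) p = smooth_gate p (truth_table i)"
  using assms by (simp add: random_gate_def if_distrib if_distribR cong: if_cong)

text \<open>Members of \<open>boolean_gates\<close> are extensional functions, hence the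
  restriction. On the four bit pairs the value is a binary digit of \<open>i\<close>.\<close>

lemma restrict_random_gate_boolean:
  assumes "i < 16"
  shows "restrict (random_gate (unit_vec 16 i)) ({0, 1} \<times> {0, 1}) \<in> boolean_gates"
  unfolding boolean_gates_def restrict_PiE_iff
proof
  fix p :: "real \<times> real" assume "p \<in> {0, 1} \<times> {0, 1}"
  then obtain k where k: "k < 4" "p = gate_input k"
    using bit_pair_gate_input by blast
  have "random_gate (unit_vec 16 i) p = real (i div 2 ^ (3 - k) mod 2)"
    using assms k by (simp add: random_gate_unit_vec smooth_gate_gate_input truth_table_def)
  then show "random_gate (unit_vec 16 i) p \<in> {0, 1}"
    by (cases "even (i div 2 ^ (3 - k))") (simp_all add: odd_iff_mod_2_eq_one)
qed

text \<open>Links the two descriptions of the lifting: a column index below \<open>2 * b\<close> on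
  the circuit side, and separate sums over bits and negated bits in the law of the channel.\<close>

lemma lifted_bits:
  assumes "x \<in> bits b"
  shows "x @\<^sub>v (ones (dim_vec x) - x) \<in> bits (2 * b)"
    and "j < b \<Longrightarrow> (x @\<^sub>v (ones (dim_vec x) - x)) $ j = x $ j"
    and "j < b \<Longrightarrow> (x @\<^sub>v (ones (dim_vec x) - x)) $ (j + b) = 1 - x $ j"
proof -
  have x: "dim_vec x = b" "\<And>i. i < b \<Longrightarrow> x $ i \<in> {0, 1}"
    using assms by (auto simp: bits_def)
  have "(x @\<^sub>v (ones (dim_vec x) - x)) $ i \<in> {0, 1}" if "i < 2 * b" for i
  proof (cases "i < b")
    case True
    then have "(x @\<^sub>v (ones (dim_vec x) - x)) $ i = x $ i"
      using x(1) by (simp add: ones_def)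
    then show ?thesis
      using x(2)[OF True] by simp
  next
    case False
    then have "(x @\<^sub>v (ones (dim_vec x) - x)) $ i = 1 - x $ (i - b)" "i - b < b"
      using x(1) that by (simp_all add: ones_def)
    then show ?thesis
      using x(2)[of "i - b"] by (auto simp del: index_append_vec)
  qed
  moreover have "x @\<^sub>v (ones (dim_vec x) - x) \<in> carrier_vec (2 * b)"
    using x(1) by (intro carrier_vecI) (simp add: ones_def)
  ultimately show "x @\<^sub>v (ones (dim_vec x) - x) \<in> bits (2 * b)"
    unfolding bits_def by blast
qed (use assms in \<open>auto simp: bits_def ones_def\<close>)

lemma boolean_gate_bit:
  "\<lbrakk>g \<in> boolean_gates; y \<in> {0, 1}; z \<in> {0, 1}\<rbrakk> \<Longrightarrow> g (y, z) \<in> {0, 1}"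
  unfolding boolean_gates_def by (erule PiE_mem) auto

section \<open>Circuits from wiring data\<close>

text \<open>Every arc joins consecutive layers, and disjointness of the layers leaves only one
  possible layer for the tail once the layer of the head is known.\<close>

lemma CIRCUIT_pred_layer:
  assumes C: "C \<in> CIRCUIT b \<Delta> \<Upsilon>" and v: "v \<in> layer C (Suc (Suc l))"
    and l: "Suc (Suc l) \<le> \<Delta>"
  shows "pred1 C v \<in> layer C (Suc l)" "pred2 C v \<in> layer C (Suc l)"
proof -
  have disj: "disjoint_family_on (layer C) {..\<Delta>}"
    and arcs: "\<And>a. a \<in> arcs (graph C) \<Longrightarrow>
        \<exists>l<\<Delta>. tail (graph C) a \<in> layer C l \<and> head (graph C) a \<in> layer C (Suc l)"
    using C unfolding CIRCUIT_def by blast+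
  have "\<forall>l\<in>{2..\<Delta>}. \<forall>v\<in>layer C l. in_arcs (graph C) v = {in_arc1 C v, in_arc2 C v}"
    using C unfolding CIRCUIT_def by blast
  moreover have "Suc (Suc l) \<in> {2..\<Delta>}"
    using l by simp
  ultimately have ins: "in_arcs (graph C) v = {in_arc1 C v, in_arc2 C v}"
    using v by blast
  have "tail (graph C) a \<in> layer C (Suc l)" if "a \<in> in_arcs (graph C) v" for a
  proof -
    obtain m where m: "m < \<Delta>" "tail (graph C) a \<in> layer C m" "v \<in> layer C (Suc m)"
      using arcs[of a] \<open>a \<in> in_arcs (graph C) v\<close> by (auto simp: in_arcs_def)
    have "Suc m = Suc (Suc l)"
      using disjoint_family_onD[OF disj, of "Suc m" "Suc (Suc l)"] m v l by auto
    with m show ?thesis by simp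
  qed
  with ins show "pred1 C v \<in> layer C (Suc l)" "pred2 C v \<in> layer C (Suc l)"
    by auto
qed

text \<open>Gates are specified on bit pairs only, so bits must be propagated layer by layer. Stated
  for every circuit of the class, it serves both the circuit constructed below and the count of
  induced functions.\<close>

lemma layer_value_bit:
  assumes C: "C \<in> CIRCUIT b \<Delta> \<Upsilon>" and x: "x \<in> bits b"
  shows "\<lbrakk>Suc l \<le> \<Delta>; v \<in> layer C (Suc l)\<rbrakk> \<Longrightarrow> layer_value C x (Suc l) v \<in> {0, 1}"
proof (induction l arbitrary: v)
  case 0
  then obtain j where "j < 2 * b" "lift_row C v = unit_vec (2 * b) j"
    using C by (auto simp: CIRCUIT_def)
  then show ?case
    using lifted_bits(1)[OF x] by (auto simp: bits_def scalar_prod_left_unit)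
next
  case (Suc l)
  have "\<forall>l\<in>{2..\<Delta>}. \<forall>v\<in>layer C l. gate C v \<in> boolean_gates"
    using C unfolding CIRCUIT_def by blast
  moreover have "Suc (Suc l) \<in> {2..\<Delta>}"
    using Suc.prems by simp
  ultimately have "gate C v \<in> boolean_gates"
    using Suc.prems(2) by blast
  note gate = boolean_gate_bit[OF this] and IH = Suc.IH[OF Suc_leD[OF Suc.prems(1)]]
    and preds = CIRCUIT_pred_layer[OF C Suc.prems(2,1)]
  show ?case
    unfolding layer_value.simps by (rule gate[OF IH[OF preds(1)] IH[OF preds(2)]])
qed

lemma circuit_fun_bits:
  assumes "C \<in> CIRCUIT b \<Delta> \<Upsilon>" "1 \<le> \<Delta>" "x \<in> bits b"
  shows "circuit_fun \<Delta> C x \<in> bits 1"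
proof -
  obtain l where l: "\<Delta> = Suc l"
    using assms by (cases \<Delta>) auto
  have "output_node C \<in> layer C \<Delta>"
    using assms by (auto simp: CIRCUIT_def)
  then show ?thesis
    using layer_value_bit[OF assms(1,3), of l "output_node C"] l
    by (auto simp: bits_def circuit_fun_def)
qed

section \<open>The circuit with given bit selection, edges and gates\<close>

text \<open>A sampled outcome in deterministic form. The index \<open>l\<close> of
  \<open>edge\<close> and \<open>op\<close> is the layer that the arcs leave, as in the stochastic
  model: \<open>edge l j 0\<close> and \<open>edge l j 1\<close> feed gate \<open>op l j\<close>,
  which sits at position \<open>j\<close> of layer \<open>l + 1\<close>.\<close>

locale wiring =
  fixes \<Delta> \<Upsilon> :: nat and B :: "nat \<Rightarrow> nat" and sel :: "nat \<Rightarrow> nat"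
    and edge :: "nat \<Rightarrow> nat \<Rightarrow> nat \<Rightarrow> nat" and op :: "nat \<Rightarrow> nat \<Rightarrow> real \<times> real \<Rightarrow> real"
  assumes depth: "1 \<le> \<Delta>"
    and width: "l \<le> \<Delta> \<Longrightarrow> 1 \<le> B l \<and> B l \<le> \<Upsilon>"
    and out: "B \<Delta> = 1"
    and sel_less: "j < B 1 \<Longrightarrow> sel j < 2 * B 0"
    and edge_less: "\<lbrakk>l \<in> {1..<\<Delta>}; j < B (l + 1); k < 2\<rbrakk> \<Longrightarrow> edge l j k < B l"
    and op_boolean: "\<lbrakk>l \<in> {1..<\<Delta>}; j < B (l + 1)\<rbrakk> \<Longrightarrow> op l j \<in> boolean_gates"
begin

text \<open>Node \<open>(l, j)\<close> is the \<open>j\<close>-th one in layer \<open>l\<close>; the arc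
  \<open>(v, k)\<close> is the \<open>k\<close>-th one into \<open>v\<close>. A first-layer node has
  only one arc, any later one has two, so \<open>min l 2\<close> counts them.\<close>

definition node :: "nat \<Rightarrow> nat \<Rightarrow> nat" where
  "node l j = prod_encode (l, j)"

definition level :: "nat \<Rightarrow> nat" where
  "level v = fst (prod_decode v)"

definition pos :: "nat \<Rightarrow> nat" where
  "pos v = snd (prod_decode v)"

text \<open>A bit and its negation come from the same input node, hence the remainder modulo
  \<open>B 0\<close>. Here \<open>l\<close> is the layer of the head, so \<open>edge\<close> is
  taken at \<open>l - 1\<close>.\<close>

definition source :: "nat \<Rightarrow> nat \<Rightarrow> nat \<Rightarrow> nat" where
  "source l j k = (if l = 1 then sel j mod B 0 else edge (l - 1) j k)"

definition wired_graph :: "(nat, nat) pre_digraph" where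
  "wired_graph = \<lparr>
     verts = (\<Union>l\<le>\<Delta>. node l ` {..<B l}),
     arcs = (\<Union>l\<in>{1..\<Delta>}. \<Union>j<B l. (\<lambda>k. prod_encode (node l j, k)) ` {..<min l 2}),
     tail = (\<lambda>a. let (v, k) = prod_decode a in node (level v - 1) (source (level v) (pos v) k)),
     head = (\<lambda>a. fst (prod_decode a))\<rparr>"

definition wired_circuit :: circuit where
  "wired_circuit = \<lparr>
     graph = wired_graph,
     layer = (\<lambda>l. node l ` {..<B l}),
     input_node = node 0,
     lift_row = (\<lambda>v. unit_vec (2 * B 0) (sel (pos v))),
     in_arc1 = (\<lambda>v. prod_encode (v, 0)),
     in_arc2 = (\<lambda>v. prod_encode (v, 1)),
     gate = (\<lambda>v. op (level v - 1) (pos v)),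
     output_node = node \<Delta> 0\<rparr>"

lemma level_node [simp]: "level (node l j) = l"
  and pos_node [simp]: "pos (node l j) = j"
  by (simp_all add: level_def pos_def node_def)

lemma node_eq_iff [simp]: "node l j = node m i \<longleftrightarrow> l = m \<and> j = i"
  by (simp add: node_def)

lemma tail_wired [simp]:
  "tail wired_graph (prod_encode (v, k)) = node (level v - 1) (source (level v) (pos v) k)"
  and head_wired [simp]: "head wired_graph (prod_encode (v, k)) = v"
  by (simp_all add: wired_graph_def)

lemma source_less:
  assumes "l \<in> {1..\<Delta>}" "j < B l" "k < min l 2"
  shows "source l j k < B (l - 1)"
proof (cases "l = 1")
  case True
  \<comment> \<open>Since \<open>B 0\<close> is positive, a remainder modulo \<open>B 0\<close> is
    smaller than \<open>B 0\<close>.\<close>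
  then show ?thesis
    using width[of 0] by (simp add: source_def)
next
  case False
  then show ?thesis
    using assms edge_less[of "l - 1" j k] by (cases l) (auto simp: source_def)
qed

lemma arcs_wiredE:
  assumes "a \<in> arcs wired_graph"
  obtains l j k where "l \<in> {1..\<Delta>}" "j < B l" "k < min l 2" "a = prod_encode (node l j, k)"
  using assms by (auto simp: wired_graph_def)

lemma in_arcs_wired:
  assumes "l \<in> {1..\<Delta>}" "j < B l"
  shows "in_arcs wired_graph (node l j) = (\<lambda>k. prod_encode (node l j, k)) ` {..<min l 2}"
  using assms by (fastforce simp: in_arcs_def wired_graph_def)

lemma arcs_wired_layers:
  assumes "a \<in> arcs wired_graph"
  shows "\<exists>l<\<Delta>. tail wired_graph a \<in> node l ` {..<B l} \<and> head wired_graph a \<in> node (Suc l) ` {..<B (Suc l)}"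
  using assms
proof (rule arcs_wiredE)
  fix l j k assume a: "l \<in> {1..\<Delta>}" "j < B l" "k < min l 2" "a = prod_encode (node l j, k)"
  then show ?thesis
    using source_less[of l j k] by (intro exI[of _ "l - 1"]) auto
qed

lemma wired_graph_fin_digraph: "fin_digraph wired_graph"
proof
  have *: "tail wired_graph a \<in> verts wired_graph \<and> head wired_graph a \<in> verts wired_graph"
    if "a \<in> arcs wired_graph" for a
  proof -
    obtain l where "l < \<Delta>" "tail wired_graph a \<in> node l ` {..<B l}"
      "head wired_graph a \<in> node (Suc l) ` {..<B (Suc l)}"
      using arcs_wired_layers[OF \<open>a \<in> arcs wired_graph\<close>] by blast
    then show ?thesis
      by (auto simp: wired_graph_def intro: less_imp_le Suc_leI)
  qed
  show "tail wired_graph a \<in> verts wired_graph" "head wired_graph a \<in> verts wired_graph"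
    if "a \<in> arcs wired_graph" for a
    using * that by auto
qed (auto simp: wired_graph_def)

text \<open>The level strictly increases along every arc, so the edge relation embeds into a
  well-founded one.\<close>

lemma wired_graph_acyclic: "acyclic (arcs_ends wired_graph)"
proof (rule acyclic_subset[OF wf_acyclic[OF wf_inv_image[OF wf_less_than, of level]]])
  show "arcs_ends wired_graph \<subseteq> inv_image less_than level"
    using arcs_wired_layers by (fastforce simp: arcs_ends_def arc_to_ends_def)
qed

lemma wired_circuit_CIRCUIT: "wired_circuit \<in> CIRCUIT (B 0) \<Delta> \<Upsilon>"
proof -
  have first: "\<exists>i<2 * B 0. unit_vec (2 * B 0) (sel j) = (unit_vec (2 * B 0) i :: real vec) \<and>
      (\<exists>a. in_arcs wired_graph (node 1 j) = {a} \<and> tail wired_graph a = node 0 (i mod B 0))"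
    if "j < B 1" for j
    \<comment> \<open>The column is \<open>sel j\<close>, and the single arc into a first-layer node
      carries the number 0.\<close>
    using that sel_less[of j] depth
    by (intro exI[of _ "sel j"] conjI exI[of _ "prod_encode (node 1 j, 0)"])
      (simp_all add: in_arcs_wired source_def lessThan_Suc)
  have later: "in_degree wired_graph (node l j) = 2 \<and>
      in_arcs wired_graph (node l j) = {prod_encode (node l j, 0), prod_encode (node l j, 1)} \<and>
      op (l - 1) j \<in> boolean_gates"
    if "l \<in> {2..\<Delta>}" "j < B l" for l j
  proof -
    \<comment> \<open>The two arcs have different codes even if their tails coincide, so the
      in-degree is 2 also for parallel edges.\<close>
    have "in_arcs wired_graph (node l j) = {prod_encode (node l j, 0), prod_encode (node l j, 1)}"
      using that by (auto simp: in_arcs_wired numeral_2_eq_2 lessThan_Suc)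
    then show ?thesis
      using that op_boolean[of "l - 1" j] by (cases l) (auto simp: in_degree_def)
  qed
  have "bij_betw (node 0) {..<B 0} (node 0 ` {..<B 0})"
    by (auto simp: bij_betw_def inj_on_def)
  moreover have "card (node l ` {..<B l}) \<le> \<Upsilon>" if "l \<le> \<Delta>" for l
    using width[OF that] card_image_le[of "{..<B l}" "node l"] by simp
  moreover have "node \<Delta> ` {..<B \<Delta>} = {node \<Delta> 0}"
    by (simp add: out lessThan_Suc)
  moreover have "disjoint_family_on (\<lambda>l. node l ` {..<B l}) {..\<Delta>}"
    by (auto simp: disjoint_family_on_def)
  moreover have "verts wired_graph = (\<Union>l\<le>\<Delta>. node l ` {..<B l})"
    by (simp add: wired_graph_def)
  ultimately show ?thesis
    using first later wired_graph_fin_digraph wired_graph_acyclic arcs_wired_layers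
    unfolding CIRCUIT_def wired_circuit_def by simp
qed

lemma layer_value_wired_1:
  assumes "x \<in> bits (B 0)" "j < B 1"
  shows "layer_value wired_circuit x (Suc 0) (node (Suc 0) j) = (x @\<^sub>v (ones (dim_vec x) - x)) $ sel j"
  using lifted_bits(1)[OF assms(1)] sel_less[OF assms(2)]
  by (simp add: wired_circuit_def bits_def scalar_prod_left_unit)

lemma layer_value_wired_Suc:
  "layer_value wired_circuit x (Suc (Suc l)) (node (Suc (Suc l)) j) =
    op (Suc l) j (layer_value wired_circuit x (Suc l) (node (Suc l) (edge (Suc l) j 0)),
                  layer_value wired_circuit x (Suc l) (node (Suc l) (edge (Suc l) j 1)))"
proof -
  have "pred1 wired_circuit (node (Suc (Suc l)) j) = node (Suc l) (edge (Suc l) j 0)"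
    "pred2 wired_circuit (node (Suc (Suc l)) j) = node (Suc l) (edge (Suc l) j 1)"
    "gate wired_circuit (node (Suc (Suc l)) j) = op (Suc l) j"
    by (simp_all add: wired_circuit_def source_def)
  then show ?thesis
    by (simp only: layer_value.simps)
qed

text \<open>The rule for \<open>s\<close> is assumed only where the previous state consists of bits,
  since smooth and Boolean gates are compared only there. The induction equates \<open>s\<close>
  with the circuit values, whose being bits then justifies the next application of the rule.\<close>

lemma wired_circuit_fun:
  assumes x: "x \<in> bits (B 0)" and dim: "dim_vec (s \<Delta>) = 1"
    and s1: "\<And>j. j < B 1 \<Longrightarrow> s 1 $ j = (x @\<^sub>v (ones (dim_vec x) - x)) $ sel j"
    and step: "\<And>l j. \<lbrakk>l \<in> {1..<\<Delta>}; j < B (l + 1); \<And>k. k < B l \<Longrightarrow> s l $ k \<in> {0, 1}\<rbrakk> \<Longrightarrow>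
        s (l + 1) $ j = op l j (s l $ edge l j 0, s l $ edge l j 1)"
  shows "s \<Delta> = circuit_fun \<Delta> wired_circuit x"
proof -
  have bit: "layer_value wired_circuit x (Suc l) (node (Suc l) j) \<in> {0, 1}"
    if "Suc l \<le> \<Delta>" "j < B (Suc l)" for l j
    using layer_value_bit[OF wired_circuit_CIRCUIT x, of l "node (Suc l) j"] that
    by (simp add: wired_circuit_def)
  have "\<forall>j<B (Suc l). s (Suc l) $ j = layer_value wired_circuit x (Suc l) (node (Suc l) j)"
    if "Suc l \<le> \<Delta>" for l
    using that
  proof (induction l)
    case 0
    then show ?case
      using s1 layer_value_wired_1[OF x] by simp
  next
    case (Suc l)
    then have IH: "\<forall>j<B (Suc l). s (Suc l) $ j = layer_value wired_circuit x (Suc l) (node (Suc l) j)"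
      by simp
    show ?case
    proof (intro allI impI)
      fix j assume j: "j < B (Suc (Suc l))"
      have "s (Suc l) $ k \<in> {0, 1}" if "k < B (Suc l)" for k
        using IH bit[of l k] Suc.prems that by simp
      then have "s (Suc (Suc l)) $ j = op (Suc l) j (s (Suc l) $ edge (Suc l) j 0, s (Suc l) $ edge (Suc l) j 1)"
        using step[of "Suc l" j] Suc.prems j by simp
      then show "s (Suc (Suc l)) $ j = layer_value wired_circuit x (Suc (Suc l)) (node (Suc (Suc l)) j)"
        using IH edge_less[of "Suc l" j 0] edge_less[of "Suc l" j 1] Suc.prems j
        by (simp only: layer_value_wired_Suc) simp
    qed
  qed
  \<comment> \<open>The last layer is \<open>Suc (\<Delta> - 1)\<close>, and its only node has
    position 0.\<close>
  from this[of "\<Delta> - 1"] show ?thesis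
    using depth dim out by (auto simp: circuit_fun_def wired_circuit_def)
qed

end

section \<open>Stochastic Boolean circuits\<close>

lemma mult_mat_vec_row_unit:
  fixes A :: "'a :: semiring_1 mat"
  assumes "A \<in> carrier_mat m n" "v \<in> carrier_vec n" "j < m" "k < n" "row A j = unit_vec n k"
  shows "(A *\<^sub>v v) $ j = v $ k"
  using assms by (simp add: scalar_prod_left_unit)

text \<open>A case distinction suffices: the channel fixes the dimension in the first layer, and
  \<open>vec\<close> fixes it in every later one.\<close>

lemma sbc_state_dim:
  assumes "bit_lifting_channel M b (B 1) W X" "\<omega> \<in> space M" "x \<in> bits b" "1 \<le> l"
  shows "sbc_state B X G E1 E2 l \<omega> x \<in> carrier_vec (B l)"
proof -
  have "X \<omega> x \<in> carrier_vec (B 1)"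
    using assms by (auto simp: bit_lifting_channel_def bits_def)
  then show ?thesis
    using assms(4) by (cases "(B, X, G, E1, E2, l, \<omega>, x)" rule: sbc_state.cases) (auto simp: Let_def)
qed

text \<open>The deterministic half of the argument, for one fixed outcome. In \<open>lift\<close>
  the column is chosen before the input \<open>x\<close>, so a single circuit works for all
  inputs.\<close>

lemma computed_by_one_hot_choices:
  assumes depth: "1 \<le> \<Delta>" and width: "\<And>l. l \<le> \<Delta> \<Longrightarrow> 1 \<le> B l \<and> B l \<le> \<Upsilon>" and out: "B \<Delta> = 1"
    and X: "bit_lifting_channel M (B 0) (B 1) W X" and \<omega>: "\<omega> \<in> space M"
    and E1: "\<And>l. l \<in> {1..<\<Delta>} \<Longrightarrow> E1 l \<omega> \<in> carrier_mat (B (l + 1)) (B l)"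
    and E2: "\<And>l. l \<in> {1..<\<Delta>} \<Longrightarrow> E2 l \<omega> \<in> carrier_mat (B (l + 1)) (B l)"
    and lift: "\<And>i. i < B 1 \<Longrightarrow> \<exists>j<2 * B 0. \<forall>x\<in>bits (B 0). X \<omega> x $ i = (x @\<^sub>v (ones (dim_vec x) - x)) $ j"
    and gate: "\<And>l j. \<lbrakk>l \<in> {1..<\<Delta>}; j < B (l + 1)\<rbrakk> \<Longrightarrow> \<exists>i<16. G l j \<omega> = unit_vec 16 i"
    and row1: "\<And>l j. \<lbrakk>l \<in> {1..<\<Delta>}; j < B (l + 1)\<rbrakk> \<Longrightarrow> \<exists>k<B l. row (E1 l \<omega>) j = unit_vec (B l) k"
    and row2: "\<And>l j. \<lbrakk>l \<in> {1..<\<Delta>}; j < B (l + 1)\<rbrakk> \<Longrightarrow> \<exists>k<B l. row (E2 l \<omega>) j = unit_vec (B l) k"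
  shows "computed_by_CIRCUIT (B 0) \<Delta> \<Upsilon> (sbc_state B X G E1 E2 \<Delta> \<omega>)"
proof -
  obtain sel where sel: "\<And>i. i < B 1 \<Longrightarrow> sel i < 2 * B 0"
      "\<And>i x. \<lbrakk>i < B 1; x \<in> bits (B 0)\<rbrakk> \<Longrightarrow> X \<omega> x $ i = (x @\<^sub>v (ones (dim_vec x) - x)) $ sel i"
    using lift by metis
  obtain g where g: "\<And>l j. \<lbrakk>l \<in> {1..<\<Delta>}; j < B (l + 1)\<rbrakk> \<Longrightarrow> g l j < 16 \<and> G l j \<omega> = unit_vec 16 (g l j)"
    using gate by metis
  obtain e1 where e1: "\<And>l j. \<lbrakk>l \<in> {1..<\<Delta>}; j < B (l + 1)\<rbrakk> \<Longrightarrow>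
      e1 l j < B l \<and> row (E1 l \<omega>) j = unit_vec (B l) (e1 l j)"
    using row1 by metis
  obtain e2 where e2: "\<And>l j. \<lbrakk>l \<in> {1..<\<Delta>}; j < B (l + 1)\<rbrakk> \<Longrightarrow>
      e2 l j < B l \<and> row (E2 l \<omega>) j = unit_vec (B l) (e2 l j)"
    using row2 by metis
  define edge where "edge l j k = (if k = 0 then e1 l j else e2 l j)" for l j and k :: nat
  define op where "op l j = restrict (random_gate (unit_vec 16 (g l j))) ({0, 1} \<times> {0, 1})" for l j
  interpret wiring \<Delta> \<Upsilon> B sel edge op
  proof
    show "edge l j k < B l" if "l \<in> {1..<\<Delta>}" "j < B (l + 1)" "k < 2" for l j k
      using e1 e2 that by (auto simp: edge_def)
    show "op l j \<in> boolean_gates" if "l \<in> {1..<\<Delta>}" "j < B (l + 1)" for l j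
      using g[OF that] unfolding op_def by (blast intro: restrict_random_gate_boolean)
  qed (use depth width out sel in auto)
  have "sbc_state B X G E1 E2 \<Delta> \<omega> x = circuit_fun \<Delta> wired_circuit x" if x: "x \<in> bits (B 0)" for x
  proof (rule wired_circuit_fun[OF x, where s = "\<lambda>l. sbc_state B X G E1 E2 l \<omega> x"])
    let ?s = "\<lambda>l. sbc_state B X G E1 E2 l \<omega> x"
    show "dim_vec (?s \<Delta>) = 1"
      using sbc_state_dim[where B = B, OF X \<omega> x depth] out by auto
    show "?s 1 $ j = (x @\<^sub>v (ones (dim_vec x) - x)) $ sel j" if "j < B 1" for j
      using sel(2)[OF that x] by simp
    fix l j assume l: "l \<in> {1..<\<Delta>}" and j: "j < B (l + 1)"
      and bit: "\<And>k. k < B l \<Longrightarrow> ?s l $ k \<in> {0, 1}"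
    obtain m where m: "l = Suc m"
      using l by (cases l) auto
    have s: "?s l \<in> carrier_vec (B l)"
      using sbc_state_dim[where B = B, OF X \<omega> x] l by simp
    have "(E1 l \<omega> *\<^sub>v ?s l) $ j = ?s l $ e1 l j" "(E2 l \<omega> *\<^sub>v ?s l) $ j = ?s l $ e2 l j"
      using mult_mat_vec_row_unit[OF E1[OF l] s j] mult_mat_vec_row_unit[OF E2[OF l] s j]
        e1[OF l j] e2[OF l j] by auto
    then have "?s (l + 1) $ j = random_gate (unit_vec 16 (g l j)) (?s l $ e1 l j, ?s l $ e2 l j)"
      using g[OF l j] j by (simp add: m Let_def)
    \<comment> \<open>On bit pairs the restriction in the definition of \<open>op\<close> has no
      effect.\<close>
    moreover have "(?s l $ e1 l j, ?s l $ e2 l j) \<in> {0, 1} \<times> {0, 1}"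
      using bit e1[OF l j] e2[OF l j] by blast
    ultimately show "?s (l + 1) $ j = op l j (?s l $ edge l j 0, ?s l $ edge l j 1)"
      unfolding op_def by (simp only: edge_def restrict_apply' if_True if_False one_neq_zero refl)
  qed
  then show ?thesis
    using wired_circuit_CIRCUIT unfolding computed_by_CIRCUIT_def by blast
qed

section \<open>Almost sure shape of the random choices\<close>

text \<open>The sixteen events are disjoint and their probabilities are the softmax weights, so
  their union has probability one.\<close>

lemma (in prob_space) AE_gate_choice:
  assumes G: "gate_choice M w G" and w: "dim_vec w = 16"
  shows "AE \<omega> in M. \<exists>i<16. G \<omega> = unit_vec 16 i"
proof -
  let ?A = "\<lambda>i. {\<omega> \<in> space M. G \<omega> = unit_vec 16 i}"
  have carrier: "G \<omega> \<in> carrier_vec 16" if "\<omega> \<in> space M" for \<omega>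
    using G that by (auto simp: gate_choice_def random_vector_def)
  have [measurable]: "(\<lambda>\<omega>. G \<omega> $ k) \<in> borel_measurable M" if "k < 16" for k
    using G that by (auto simp: gate_choice_def random_vector_def)
  \<comment> \<open>Measurability is given for coordinates, so equality of vectors is split into
    sixteen scalar equations.\<close>
  have "?A i = {\<omega> \<in> space M. \<forall>k\<in>{..<16}. G \<omega> $ k = unit_vec 16 i $ k}" for i
    using carrier by (auto intro!: eq_vecI)
  also have "\<dots> i \<in> events" for i
    by (rule sets.sets_Collect_finite_All) auto
  finally have meas: "?A i \<in> events" for i .
  have "prob (\<Union>i<16. ?A i) = (\<Sum>i<16. prob (?A i))"
    using meas
    by (intro finite_measure_finite_Union)
      (auto simp: disjoint_family_on_def)
  also have "\<dots> = 1"
    using G sum_softmax[of w] w by (simp add: gate_choice_def)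
  finally have "AE \<omega> in M. \<omega> \<in> (\<Union>i<16. ?A i)"
    using meas by (subst (asm) prob_eq_1) auto
  then show ?thesis by eventually_elim auto
qed

text \<open>All Dirac masses of the law sit at one of the \<open>2 * b\<close> coordinate maps.
  Evaluated on the set of these maps, the law therefore gives the full softmax mass.\<close>

lemma (in prob_space) AE_bit_lifting_channel:
  assumes X: "bit_lifting_channel M b n W X" and W: "W \<in> carrier_mat n (2 * b)"
    and b: "1 \<le> b" and i: "i < n"
  shows "AE \<omega> in M. \<exists>j<2 * b. \<forall>x\<in>bits b. X \<omega> x $ i = (x @\<^sub>v (ones (dim_vec x) - x)) $ j"
proof -
  \<comment> \<open>Restriction to \<open>bits b\<close> makes these maps equal, as functions, to
    the atoms of the law.\<close>
  define coord where "coord j = (\<lambda>x\<in>bits b. (x @\<^sub>v (ones (dim_vec x) - x)) $ j)" for j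
  let ?A = "coord ` {..<2 * b}"
  let ?S = "{\<omega> \<in> space M. (\<lambda>x\<in>bits b. X \<omega> x $ i) \<in> ?A}"
  have meas: "(\<lambda>\<omega>. \<lambda>x\<in>bits b. X \<omega> x $ i) \<in> measurable M (count_space UNIV)"
    and law: "prob ?S = (\<Sum>j<b. softmax (row W i) $ j * indicator ?A (\<lambda>x\<in>bits b. x $ j)) +
           (\<Sum>j<b. softmax (row W i) $ (j + b) * indicator ?A (\<lambda>x\<in>bits b. 1 - x $ j))"
    using X i unfolding bit_lifting_channel_def by blast+
  have "(\<lambda>x\<in>bits b. x $ j) = coord j" "(\<lambda>x\<in>bits b. 1 - x $ j) = coord (j + b)" if "j < b" for j
    using that by (auto simp: coord_def lifted_bits(2,3) intro!: restrict_ext)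
  then have "(\<lambda>x\<in>bits b. x $ j) \<in> ?A" "(\<lambda>x\<in>bits b. 1 - x $ j) \<in> ?A" if "j < b" for j
    using that by auto
  then have "prob ?S = (\<Sum>j<b. softmax (row W i) $ j) + (\<Sum>j<b. softmax (row W i) $ (j + b))"
    unfolding law by simp
  also have "\<dots> = (\<Sum>j<2 * b. softmax (row W i) $ j)"
    \<comment> \<open>The index range is cut into two blocks of length \<open>b\<close>, the second
      shifted by \<open>b\<close>.\<close>
    using sum.nat_group[of "\<lambda>j. softmax (row W i) $ j" b 2]
    by (simp add: numeral_2_eq_2 lessThan_atLeast0 sum.shift_bounds_nat_ivl[of _ 0 b b, simplified] mult.commute add.commute)
  also have "\<dots> = 1"
    using sum_softmax[of "row W i"] W i b by simp
  \<comment> \<open>The target carries the discrete sigma-algebra, so every set of maps has a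
    measurable preimage.\<close>
  finally have "AE \<omega> in M. (\<lambda>x\<in>bits b. X \<omega> x $ i) \<in> ?A"
    using prob_Collect_eq_1[OF measurable_sets_Collect[OF meas, of "\<lambda>f. f \<in> ?A"]] by simp
  then show ?thesis
  proof eventually_elim
    case (elim \<omega>)
    then obtain j where j: "j < 2 * b" "(\<lambda>x\<in>bits b. X \<omega> x $ i) = coord j"
      by auto
    have "X \<omega> x $ i = (x @\<^sub>v (ones (dim_vec x) - x)) $ j" if "x \<in> bits b" for x
      using fun_cong[OF j(2), of x] that by (simp add: coord_def)
    with j(1) show ?case by blast
  qed
qed

section \<open>Measurability of the event\<close>

text \<open>\<open>bump\<close> is Borel as a case distinction between Borel functions, and the gate
  value is a finite sum of products of gate coordinates, shifted bumps and constants.\<close>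

lemma measurable_random_gate:
  assumes "random_vector M 16 G" "f \<in> borel_measurable M" "h \<in> borel_measurable M"
  shows "(\<lambda>\<omega>. random_gate (G \<omega>) (f \<omega>, h \<omega>)) \<in> borel_measurable M"
proof -
  have [measurable]: "(\<lambda>\<omega>. G \<omega> $ k) \<in> borel_measurable M" if "k < 16" for k
    using assms(1) that by (auto simp: random_vector_def)
  have "bump \<in> borel_measurable borel"
    unfolding bump_def by measurable
  then have "(\<lambda>\<omega>. bump ((f \<omega>, h \<omega>) - p)) \<in> borel_measurable M" for p
    by (rule measurable_compose_rev) (auto intro!: borel_measurable_diff borel_measurable_Pair assms)
  then show ?thesis
    unfolding random_gate_def smooth_gate_def
    by (intro borel_measurable_sum borel_measurable_times) auto
qed

lemma measurable_random_adjacency_mult: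
  assumes E: "random_adjacency M P E" and P: "P \<in> carrier_mat m n" and j: "j < m"
    and dim: "\<And>\<omega>. \<omega> \<in> space M \<Longrightarrow> s \<omega> \<in> carrier_vec n"
    and s: "\<And>k. k < n \<Longrightarrow> (\<lambda>\<omega>. s \<omega> $ k) \<in> borel_measurable M"
  shows "(\<lambda>\<omega>. (E \<omega> *\<^sub>v s \<omega>) $ j) \<in> borel_measurable M"
proof -
  have "(\<lambda>\<omega>. row (E \<omega>) j $ k) \<in> borel_measurable M" if "k < n" for k
    using E P j that by (auto simp: random_adjacency_def random_one_hot_def random_vector_def)
  then have "(\<lambda>\<omega>. \<Sum>k<n. row (E \<omega>) j $ k * s \<omega> $ k) \<in> borel_measurable M"
    using s by (intro borel_measurable_sum borel_measurable_times) auto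
  \<comment> \<open>The product entry equals this sum on \<open>space M\<close>, where the
    dimensions are known.\<close>
  also have "?this \<longleftrightarrow> ?thesis"
    using E P j dim
    by (intro measurable_cong) (fastforce simp: random_adjacency_def scalar_prod_def lessThan_atLeast0)
  finally show ?thesis .
qed

text \<open>For a fixed input, measurability passes from layer to layer through the matrix products
  and then the gates.\<close>

lemma measurable_sbc_state:
  assumes X: "bit_lifting_channel M b (B 1) W X" and x: "x \<in> bits b"
    and G: "\<And>l j. l \<in> {1..<\<Delta>} \<Longrightarrow> j < B (l + 1) \<Longrightarrow> random_vector M 16 (G l j)"
    and E1: "\<And>l. l \<in> {1..<\<Delta>} \<Longrightarrow> P l \<in> carrier_mat (B (l + 1)) (B l) \<and> random_adjacency M (P l) (E1 l)"
    and E2: "\<And>l. l \<in> {1..<\<Delta>} \<Longrightarrow> Q l \<in> carrier_mat (B (l + 1)) (B l) \<and> random_adjacency M (Q l) (E2 l)"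
  shows "\<lbrakk>Suc l \<le> \<Delta>; j < B (Suc l)\<rbrakk> \<Longrightarrow> (\<lambda>\<omega>. sbc_state B X G E1 E2 (Suc l) \<omega> x $ j) \<in> borel_measurable M"
proof (induction l arbitrary: j)
  case 0
  then have "(\<lambda>\<omega>. \<lambda>x\<in>bits b. X \<omega> x $ j) \<in> measurable M (count_space UNIV)"
    using X by (auto simp: bit_lifting_channel_def)
  then have "(\<lambda>\<omega>. (\<lambda>x\<in>bits b. X \<omega> x $ j) x) \<in> borel_measurable M"
    \<comment> \<open>Evaluation at \<open>x\<close> is measurable because its domain is
      discrete.\<close>
    by (rule measurable_compose[where g = "\<lambda>f. f x"]) simp
  then show ?case
    using x by simp
next
  case (Suc l)
  have l: "Suc l \<in> {1..<\<Delta>}" and j: "j < B (Suc l + 1)"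
    using Suc.prems by auto
  let ?s = "\<lambda>\<omega>. sbc_state B X G E1 E2 (Suc l) \<omega> x"
  have dim: "?s \<omega> \<in> carrier_vec (B (Suc l))" if "\<omega> \<in> space M" for \<omega>
    using sbc_state_dim[where B = B, OF X that x] by simp
  have s: "(\<lambda>\<omega>. ?s \<omega> $ k) \<in> borel_measurable M" if "k < B (Suc l)" for k
    using Suc.IH Suc.prems that by simp
  have "(\<lambda>\<omega>. (E1 (Suc l) \<omega> *\<^sub>v ?s \<omega>) $ j) \<in> borel_measurable M"
    "(\<lambda>\<omega>. (E2 (Suc l) \<omega> *\<^sub>v ?s \<omega>) $ j) \<in> borel_measurable M"
    using E1[OF l] E2[OF l]
    by (auto intro!: measurable_random_adjacency_mult[OF _ _ j dim s])
  then have "(\<lambda>\<omega>. random_gate (G (Suc l) j \<omega>)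
      ((E1 (Suc l) \<omega> *\<^sub>v ?s \<omega>) $ j, (E2 (Suc l) \<omega> *\<^sub>v ?s \<omega>) $ j)) \<in> borel_measurable M"
    using G[OF l j] by (intro measurable_random_gate)
  then show ?case
    using Suc.prems by (simp add: Let_def)
qed

text \<open>As \<open>M\<close> need not be complete, the event has to be measurable before an
  almost sure statement determines its probability. It is, because circuits induce only finitely
  many functions on the finite set of inputs.\<close>

lemma sets_computed_by_CIRCUIT:
  assumes \<Delta>: "1 \<le> \<Delta>"
    and dim: "\<And>\<omega> x. \<lbrakk>\<omega> \<in> space M; x \<in> bits b\<rbrakk> \<Longrightarrow> F \<omega> x \<in> carrier_vec 1"
    and F: "\<And>x. x \<in> bits b \<Longrightarrow> (\<lambda>\<omega>. F \<omega> x $ 0) \<in> borel_measurable M"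
  shows "{\<omega> \<in> space M. computed_by_CIRCUIT b \<Delta> \<Upsilon> (F \<omega>)} \<in> sets M"
proof -
  \<comment> \<open>Restriction identifies circuits that agree on all bit inputs; the class itself
    may be infinite, as node names vary.\<close>
  let ?K = "(\<lambda>C. \<lambda>x\<in>bits b. circuit_fun \<Delta> C x) ` CIRCUIT b \<Delta> \<Upsilon>"
  have "?K \<subseteq> bits b \<rightarrow>\<^sub>E bits 1"
    using circuit_fun_bits[OF _ \<Delta>] by auto
  then have "finite ?K"
    by (rule finite_subset) (intro finite_PiE finite_bits)
  have "{\<omega> \<in> space M. computed_by_CIRCUIT b \<Delta> \<Upsilon> (F \<omega>)} =
      {\<omega> \<in> space M. \<exists>f\<in>?K. \<forall>x\<in>bits b. F \<omega> x = f x}"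
    by (auto simp: computed_by_CIRCUIT_def)
  \<comment> \<open>Entry 0 determines a vector of dimension one, which leaves equations between
    real random variables and constants.\<close>
  also have "\<dots> = {\<omega> \<in> space M. \<exists>f\<in>?K. \<forall>x\<in>bits b. F \<omega> x $ 0 = f x $ 0}"
  proof -
    have "F \<omega> x = f x \<longleftrightarrow> F \<omega> x $ 0 = f x $ 0" if "\<omega> \<in> space M" "f \<in> ?K" "x \<in> bits b" for \<omega> f x
    proof -
      have "f x \<in> carrier_vec 1"
        using that by (auto simp: circuit_fun_def)
      then show ?thesis
        using dim[OF that(1,3)] by (auto intro!: eq_vecI)
    qed
    then show ?thesis by blast
  qed
  also have "\<dots> \<in> sets M"
    using F \<open>finite ?K\<close> finite_bits
    by (intro sets.sets_Collect_finite_Ex sets.sets_Collect_finite_All) auto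
  finally show ?thesis .
qed

theorem theorem4p1:
  fixes M :: "'a measure"
    and \<Delta> \<Upsilon> :: nat
    and B :: "nat \<Rightarrow> nat"
    and \<eta> :: real
    and W :: "real mat"
    and W\<sigma> W1 W2 :: "nat \<Rightarrow> real mat"
    and X :: "'a \<Rightarrow> real vec \<Rightarrow> real vec"
    and G :: "nat \<Rightarrow> nat \<Rightarrow> 'a \<Rightarrow> real vec"
    and E1 E2 :: "nat \<Rightarrow> 'a \<Rightarrow> real mat"
  assumes "prob_space M"
    and "\<Delta> \<ge> 1" and "\<Upsilon> \<ge> 1"
    and "\<And>l. l \<le> \<Delta> \<Longrightarrow> 1 \<le> B l \<and> B l \<le> \<Upsilon>"
    and "B \<Delta> = 1"
    and "\<eta> > 0"
    and "W \<in> carrier_mat (B 1) (2 * B 0)"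
    and "\<And>l. l \<in> {1..<\<Delta>} \<Longrightarrow> W\<sigma> l \<in> carrier_mat (B (l + 1)) 16"
    and "\<And>l. l \<in> {1..<\<Delta>} \<Longrightarrow> W1 l \<in> carrier_mat (B (l + 1)) (B l)"
    and "\<And>l. l \<in> {1..<\<Delta>} \<Longrightarrow> W2 l \<in> carrier_mat (B (l + 1)) (B l)"
    and "bit_lifting_channel M (B 0) (B 1) W X"
    and "\<And>l j. l \<in> {1..<\<Delta>} \<Longrightarrow> j < B (l + 1) \<Longrightarrow> gate_choice M (row (W\<sigma> l) j) (G l j)"
    and "\<And>l. l \<in> {1..<\<Delta>} \<Longrightarrow> random_adjacency M (edge_prob1 \<eta> (W1 l)) (E1 l)"
    and "\<And>l. l \<in> {1..<\<Delta>} \<Longrightarrow> random_adjacency M (edge_prob2 \<eta> (W1 l) (W2 l)) (E2 l)"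
  shows "measure M {\<omega> \<in> space M.
           computed_by_CIRCUIT (B 0) \<Delta> \<Upsilon> (stochastic_boolean_circuit \<Delta> B X G E1 E2 \<omega>)} = 1"
proof -
  interpret prob_space M by fact
  note \<Delta> = \<open>\<Delta> \<ge> 1\<close> and width = assms(4) and W = assms(7) and X = assms(11)
  have P1: "edge_prob1 \<eta> (W1 l) \<in> carrier_mat (B (l + 1)) (B l)"
    and P2: "edge_prob2 \<eta> (W1 l) (W2 l) \<in> carrier_mat (B (l + 1)) (B l)" if "l \<in> {1..<\<Delta>}" for l
    using assms(9,10)[OF that] by (auto simp: edge_prob1_def edge_prob2_def)
  let ?F = "sbc_state B X G E1 E2 \<Delta>"
  have rows: "AE \<omega> in M. \<exists>k<n. row (E \<omega>) j = unit_vec n k"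
    if "random_adjacency M P E" "P \<in> carrier_mat m n" "j < m" for P E m n j
  proof -
    have "AE \<omega> in M. row (E \<omega>) j \<in> unit_vec n ` {..<n}"
      using that by (auto simp: random_adjacency_def random_one_hot_def)
    then show ?thesis by eventually_elim auto
  qed
  \<comment> \<open>All index sets are finite, so the exceptional null sets can be united, whatever
    the joint law of the choices.\<close>
  have "AE \<omega> in M. \<forall>i\<in>{..<B 1}. \<exists>j<2 * B 0. \<forall>x\<in>bits (B 0).
      X \<omega> x $ i = (x @\<^sub>v (ones (dim_vec x) - x)) $ j"
    using AE_bit_lifting_channel[OF X W] width[of 0] by (intro AE_finite_allI) auto
  moreover have "AE \<omega> in M. \<forall>l\<in>{1..<\<Delta>}. \<forall>j\<in>{..<B (l + 1)}. \<exists>i<16. G l j \<omega> = unit_vec 16 i"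
  proof (intro AE_finite_allI)
    fix l j assume l: "l \<in> {1..<\<Delta>}" and j: "j \<in> {..<B (l + 1)}"
    then show "AE \<omega> in M. \<exists>i<16. G l j \<omega> = unit_vec 16 i"
      using assms(8)[OF l] by (intro AE_gate_choice[OF assms(12)]) auto
  qed auto
  moreover have "AE \<omega> in M. \<forall>l\<in>{1..<\<Delta>}. \<forall>j\<in>{..<B (l + 1)}. \<exists>k<B l. row (E1 l \<omega>) j = unit_vec (B l) k"
    using rows[OF assms(13) P1] by (intro AE_finite_allI) auto
  moreover have "AE \<omega> in M. \<forall>l\<in>{1..<\<Delta>}. \<forall>j\<in>{..<B (l + 1)}. \<exists>k<B l. row (E2 l \<omega>) j = unit_vec (B l) k"
    using rows[OF assms(14) P2] by (intro AE_finite_allI) auto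
  ultimately have "AE \<omega> in M. computed_by_CIRCUIT (B 0) \<Delta> \<Upsilon> (?F \<omega>)"
    \<comment> \<open>Adds membership in \<open>space M\<close>, where the dimensions of the
      matrices and of the lifted vector are guaranteed.\<close>
    using AE_space
  proof eventually_elim
    case (elim \<omega>)
    have "E1 l \<omega> \<in> carrier_mat (B (l + 1)) (B l)" "E2 l \<omega> \<in> carrier_mat (B (l + 1)) (B l)"
      if "l \<in> {1..<\<Delta>}" for l
      using assms(13,14)[OF that] P1[OF that] P2[OF that] elim(5)
      unfolding random_adjacency_def by fastforce+
    then show ?case
      using elim by (intro computed_by_one_hot_choices[OF \<Delta> width \<open>B \<Delta> = 1\<close> X]) auto
  qed
  moreover have "{\<omega> \<in> space M. computed_by_CIRCUIT (B 0) \<Delta> \<Upsilon> (?F \<omega>)} \<in> events"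
  proof (rule sets_computed_by_CIRCUIT[OF \<Delta>])
    show "?F \<omega> x \<in> carrier_vec 1" if "\<omega> \<in> space M" "x \<in> bits (B 0)" for \<omega> x
      using sbc_state_dim[where B = B, OF X that \<Delta>] \<open>B \<Delta> = 1\<close> by simp
    show "(\<lambda>\<omega>. ?F \<omega> x $ 0) \<in> borel_measurable M" if x: "x \<in> bits (B 0)" for x
    proof -
      have "random_vector M 16 (G l j)" if "l \<in> {1..<\<Delta>}" "j < B (l + 1)" for l j
        using assms(12)[OF that] by (simp add: gate_choice_def)
      then show ?thesis
        \<comment> \<open>The lemma speaks of layer \<open>Suc l\<close>, hence
          \<open>\<Delta> - 1\<close>; position 0 exists because
          \<open>B \<Delta> = 1\<close>.\<close>
        using measurable_sbc_state[where B = B and \<Delta> = \<Delta> and G = G and l = "\<Delta> - 1" and j = 0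
            and P = "\<lambda>l. edge_prob1 \<eta> (W1 l)" and Q = "\<lambda>l. edge_prob2 \<eta> (W1 l) (W2 l)", OF X x]
          P1 P2 assms(13,14) \<Delta> \<open>B \<Delta> = 1\<close>
        by simp
    qed
  qed
  ultimately show ?thesis
    unfolding stochastic_boolean_circuit_def by (subst prob_Collect_eq_1)
qed

end
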